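(* For each $n\in\mathbb{N}$, the equation $z^{n+1}=(1+z)^n$ has exactly one positive real root.
   Context: $\mathbb{N}=\{1,2,3,\dots\}$. *)

theory Defs
  imports Complex_Main
begin

end

theory Submission
  imports Defs
begin

text \<open>
  For \<open>z > 0\<close> the equation says that \<open>z * (z / (1 + z)) ^ n = 1\<close>. The left-hand side is
  continuous and strictly increasing on the nonnegative reals, vanishes at \<open>0\<close>, and is at
  least \<open>1\<close> at \<open>2 ^ n\<close>, because \<open>z / (1 + z) \<ge> 1 / 2\<close> for \<open>z \<ge> 1\<close>.
\<close>

theorem theorem2p2:
  fixes n :: nat
  assumes "n \<ge> 1"
  shows "\<exists>!z::real. z > 0 \<and> z ^ (n + 1) = (1 + z) ^ n"
proof -
  define g where "g z = z * (z / (1 + z)) ^ n" for z :: real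
  have root_iff: "z ^ (n + 1) = (1 + z) ^ n \<longleftrightarrow> g z = 1" if "z > 0" for z
    using that by (simp add: g_def power_divide divide_eq_eq)
  have g_less: "g x < g y" if "0 < x" "x < y" for x y
  proof -
    have "x / (1 + x) \<le> y / (1 + y)"
      using that by (simp add: divide_simps algebra_simps)
    then have "(x / (1 + x)) ^ n \<le> (y / (1 + y)) ^ n"
      using that by (intro power_mono) auto
    \<comment> \<open>The factor \<open>z\<close> of \<open>g\<close> supplies the strictness, so
      weak monotonicity of the power suffices; \<open>0 < x\<close> keeps that power
      positive.\<close>
    then show ?thesis
      unfolding g_def using that by (intro mult_less_le_imp_less) auto
  qed
  have "\<exists>z\<ge>0. z \<le> 2 ^ n \<and> g z = 1"
  proof (rule IVT')
    show "g 0 \<le> 1"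
      by (simp add: g_def)
    have "(1 / 2 :: real) \<le> 2 ^ n / (1 + 2 ^ n)"
      by (simp add: le_divide_eq add_pos_pos)
    then have "(1 / 2 :: real) ^ n \<le> (2 ^ n / (1 + 2 ^ n)) ^ n"
      by (rule power_mono) simp
    \<comment> \<open>The endpoint \<open>2 ^ n\<close> is chosen to cancel the bound
      \<open>(1 / 2) ^ n\<close> exactly.\<close>
    then have "(2 :: real) ^ n * (1 / 2) ^ n \<le> g (2 ^ n)"
      unfolding g_def by (rule mult_left_mono) simp
    then show "1 \<le> g (2 ^ n)"
      by (simp add: power_one_over)
    show "continuous_on {0..2 ^ n} g"
      unfolding g_def by (intro continuous_intros) auto
  qed simp
  then obtain z where "z \<ge> 0" "g z = 1"
    by blast
  \<comment> \<open>The interval contains 0, which is excluded because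
    \<open>g 0 = 0\<close>.\<close>
  moreover from this have "z \<noteq> 0"
    by (auto simp: g_def)
  ultimately have "z > 0"
    by simp
  show ?thesis
  proof (rule ex1I)
    show "z > 0 \<and> z ^ (n + 1) = (1 + z) ^ n"
      using \<open>z > 0\<close> \<open>g z = 1\<close> root_iff by blast
  next
    fix w :: real
    assume "w > 0 \<and> w ^ (n + 1) = (1 + w) ^ n"
    then have "w > 0" "g w = 1"
      using root_iff by blast+
    \<comment> \<open>By \<open>g_less\<close>, either strict order of \<open>w\<close> and
      \<open>z\<close> would give \<open>1 < 1\<close>.\<close>
    then show "w = z"
      using g_less[of w z] g_less[of z w] \<open>z > 0\<close> \<open>g z = 1\<close> by (cases w z rule: linorder_cases) auto
  qed
qed

end
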